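(* Let $n\ge 3$ be odd and let $$\omega=\sum_{1\le i<j\le n}(-1)^{i+j-1}(dx_i\wedge dx_j+dy_i\wedge dy_j)$$ be the closed 2-form on the space $\mathbb{R}^{2n}$ of plane $n$-gons. Then $\omega$ has a 2-dimensional kernel, generated by parallel translations acting diagonally on polygons, i.e. the kernel is spanned by $\sum_{i=1}^n\partial_{x_i}$ and $\sum_{i=1}^n\partial_{y_i}$.
   Context: A plane $n$-gon is an $n$-tuple $\mathbf{P}=(P_1,\dots,P_n)$ of points $P_i=(x_i,y_i)\in\mathbb{R}^2$; $(x_1,\dots,x_n,y_1,\dots,y_n)$ are coordinates on the space of $n$-gons, identified with $\mathbb{R}^{2n}$. *)

theory Defs
  imports "HOL-Analysis.Analysis"
begin

text \<open>
  The vertices of an \<open>n\<close>-gon are indexed by a finite type \<open>'n\<close>. A labelling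
  \<open>lab\<close>, a bijection from \<open>{1..n}\<close> to \<open>'n\<close>, supplies the numbering
  \<open>P\<^sub>1, \<dots>, P\<^sub>n\<close>: the vertex \<open>P\<^sub>i\<close> is \<open>P $ lab i\<close>. In particular \<open>n = CARD('n)\<close>,
  and the space of polygons is a Euclidean space of dimension \<open>2 * n\<close>, which is
  also its own tangent space at each point.
\<close>

type_synonym 'n polygon = "real ^ 2 ^ 'n"

definition xcoord :: "(nat \<Rightarrow> 'n::finite) \<Rightarrow> nat \<Rightarrow> 'n polygon \<Rightarrow> real" where
  "xcoord lab i P = P $ lab i $ 1"

definition ycoord :: "(nat \<Rightarrow> 'n::finite) \<Rightarrow> nat \<Rightarrow> 'n polygon \<Rightarrow> real" where
  "ycoord lab i P = P $ lab i $ 2"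

definition partial_x :: "(nat \<Rightarrow> 'n::finite) \<Rightarrow> nat \<Rightarrow> 'n polygon" where
  "partial_x lab i = axis (lab i) (axis 1 1)"

definition partial_y :: "(nat \<Rightarrow> 'n::finite) \<Rightarrow> nat \<Rightarrow> 'n polygon" where
  "partial_y lab i = axis (lab i) (axis 2 1)"

text \<open>
  A differential \<open>k\<close>-form on \<open>'a\<close> takes a base point followed by \<open>k\<close> tangent vectors.
\<close>

type_synonym 'a one_form = "'a \<Rightarrow> 'a \<Rightarrow> real"
type_synonym 'a two_form = "'a \<Rightarrow> 'a \<Rightarrow> 'a \<Rightarrow> real"
type_synonym 'a three_form = "'a \<Rightarrow> 'a \<Rightarrow> 'a \<Rightarrow> 'a \<Rightarrow> real"

definition differential :: "('a::real_normed_vector \<Rightarrow> real) \<Rightarrow> 'a one_form" where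
  "differential f p u = frechet_derivative f (at p) u"

definition wedge :: "'a one_form \<Rightarrow> 'a one_form \<Rightarrow> 'a two_form" where
  "wedge \<alpha> \<beta> p u v = \<alpha> p u * \<beta> p v - \<alpha> p v * \<beta> p u"

text \<open>
  The invariant formula for the exterior derivative, evaluated on constant vector
  fields, whose Lie brackets vanish.
\<close>

definition ext_deriv :: "'a::real_normed_vector two_form \<Rightarrow> 'a three_form" where
  "ext_deriv \<eta> p u v w =
     differential (\<lambda>q. \<eta> q v w) p u
     - differential (\<lambda>q. \<eta> q u w) p v
     + differential (\<lambda>q. \<eta> q u v) p w"

text \<open>
  Differentiability of the coefficients is required because \<^const>\<open>frechet_derivative\<close>
  is unspecified where no derivative exists.
\<close>

definition closed_two_form :: "'a::real_normed_vector two_form \<Rightarrow> bool" where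
  "closed_two_form \<eta> \<longleftrightarrow>
     (\<forall>p. bilinear (\<eta> p)) \<and>
     (\<forall>p u. \<eta> p u u = 0) \<and>
     (\<forall>p u v. (\<lambda>q. \<eta> q u v) differentiable (at p)) \<and>
     (\<forall>p u v w. ext_deriv \<eta> p u v w = 0)"

definition form_kernel :: "'a two_form \<Rightarrow> 'a \<Rightarrow> 'a set" where
  "form_kernel \<eta> p = {u. \<forall>v. \<eta> p u v = 0}"

definition omega :: "nat \<Rightarrow> (nat \<Rightarrow> 'n::finite) \<Rightarrow> 'n polygon two_form" where
  "omega n lab P u v =
     (\<Sum>(i, j) \<in> {(i, j). 1 \<le> i \<and> i < j \<and> j \<le> n}.
        (-1) ^ (i + j - 1) *
        (wedge (differential (xcoord lab i)) (differential (xcoord lab j)) P u v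
         + wedge (differential (ycoord lab i)) (differential (ycoord lab j)) P u v))"

definition translate :: "real ^ 2 \<Rightarrow> 'n::finite polygon \<Rightarrow> 'n polygon" where
  "translate a P = (\<chi> k. P $ k + a)"

text \<open>The infinitesimal generator at \<open>P\<close> of the flow of translations along \<open>a\<close>.\<close>

definition translation_field :: "real ^ 2 \<Rightarrow> 'n::finite polygon \<Rightarrow> 'n polygon" where
  "translation_field a P = vector_derivative (\<lambda>t. translate (t *\<^sub>R a) P) (at 0)"

end

theory Submission
  imports Defs
begin

text \<open>
  Put \<open>s\<^sub>k(a) = (\<Sum>i<k. (-1)\<^sup>i a\<^sub>i) - (\<Sum>i>k. (-1)\<^sup>i a\<^sub>i)\<close>. Pairing a vector with
  the coordinate field of \<open>x\<^sub>k\<close> gives \<open>s\<^sub>k\<close> of its x-coordinates up to sign, and likewise for y, so the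
  kernel is cut out by the equations \<open>s\<^sub>k = 0\<close>. Since
  \<open>s\<^sub>k\<^sub>+\<^sub>1(a) - s\<^sub>k(a) = (-1)\<^sup>k (a\<^sub>k - a\<^sub>k\<^sub>+\<^sub>1)\<close>, these equations force all \<open>a\<^sub>k\<close> to be equal;
  conversely, for constant \<open>a\<close> all \<open>s\<^sub>k\<close> agree with \<open>s\<^sub>1\<close>, an alternating sum of
  \<open>n - 1\<close> equal terms, which vanishes because \<open>n\<close> is odd.
\<close>

definition alt_sum_diff :: "nat \<Rightarrow> (nat \<Rightarrow> real) \<Rightarrow> nat \<Rightarrow> real" where
  "alt_sum_diff n a k = (\<Sum>i=1..<k. (-1) ^ i * a i) - (\<Sum>i=Suc k..n. (-1) ^ i * a i)"

text \<open>The part of \<open>omega\<close> seen by a single coordinate. The x- and y-coordinates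
  do not interact, so \<open>omega\<close> splits into two copies of this form.\<close>

definition alt_form :: "nat \<Rightarrow> (nat \<Rightarrow> real) \<Rightarrow> (nat \<Rightarrow> real) \<Rightarrow> real" where
  "alt_form n a b =
     (\<Sum>(i, j) \<in> {(i, j). 1 \<le> i \<and> i < j \<and> j \<le> n}. (-1) ^ (i + j - 1) * (a i * b j - a j * b i))"

lemma minus_one_power_pred:
  assumes "0 < k"
  shows "(-1) ^ (k - 1) = - ((-1) ^ k :: 'a::ring_1)"
  using assms by (cases k) auto

text \<open>Both orders of summation are provided so that a chosen index, the larger or the smaller
  of the pair, can be made the outer one.\<close>

lemma sum_less_pairs:
  fixes f :: "nat \<Rightarrow> nat \<Rightarrow> 'a::comm_monoid_add"
  shows "(\<Sum>(i, j) \<in> {(i, j). 1 \<le> i \<and> i < j \<and> j \<le> n}. f i j) = (\<Sum>j=1..n. \<Sum>i=1..<j. f i j)"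
    and "(\<Sum>(i, j) \<in> {(i, j). 1 \<le> i \<and> i < j \<and> j \<le> n}. f i j) = (\<Sum>i=1..n. \<Sum>j=Suc i..n. f i j)"
proof -
  show "(\<Sum>(i, j) \<in> {(i, j). 1 \<le> i \<and> i < j \<and> j \<le> n}. f i j) = (\<Sum>j=1..n. \<Sum>i=1..<j. f i j)"
    by (subst sum.Sigma, simp, simp,
        rule sum.reindex_bij_witness[where i = prod.swap and j = prod.swap]) auto
  have "{(i, j). 1 \<le> i \<and> i < j \<and> j \<le> n} = (SIGMA i:{1..n}. {Suc i..n})"
    by auto
  then show "(\<Sum>(i, j) \<in> {(i, j). 1 \<le> i \<and> i < j \<and> j \<le> n}. f i j) = (\<Sum>i=1..n. \<Sum>j=Suc i..n. f i j)"
    by (subst sum.Sigma) auto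
qed

text \<open>Collect the coefficient of \<open>b k\<close>: it comes from the pairs
  \<open>(k, j)\<close> with \<open>j > k\<close> and the pairs \<open>(i, k)\<close> with
  \<open>i < k\<close>, with opposite signs. The sign of each pair factors as
  \<open>-((-1) ^ i * (-1) ^ j)\<close>.\<close>

lemma alt_form_eq_sum: "alt_form n a b = - (\<Sum>k=1..n. (-1) ^ k * b k * alt_sum_diff n a k)"
proof -
  have "alt_form n a b =
      (\<Sum>(i, j) \<in> {(i, j). 1 \<le> i \<and> i < j \<and> j \<le> n}. ((-1) ^ i * b i) * ((-1) ^ j * a j))
      - (\<Sum>(i, j) \<in> {(i, j). 1 \<le> i \<and> i < j \<and> j \<le> n}. ((-1) ^ i * a i) * ((-1) ^ j * b j))"
    unfolding alt_form_def sum_subtractf[symmetric]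
    by (intro sum.cong) (auto simp: minus_one_power_pred power_add algebra_simps simp del: One_nat_def)
  also have "\<dots> = (\<Sum>k=1..n. \<Sum>j=Suc k..n. ((-1) ^ k * b k) * ((-1) ^ j * a j))
      - (\<Sum>k=1..n. \<Sum>i=1..<k. ((-1) ^ i * a i) * ((-1) ^ k * b k))"
    by (simp only: sum_less_pairs(1)[of "\<lambda>i j. ((-1) ^ i * a i) * ((-1) ^ j * b j)"]
        sum_less_pairs(2)[of "\<lambda>i j. ((-1) ^ i * b i) * ((-1) ^ j * a j)"])
  also have "\<dots> = (\<Sum>k=1..n. - ((-1) ^ k * b k * alt_sum_diff n a k))"
    unfolding alt_sum_diff_def sum_subtractf[symmetric]
    by (intro sum.cong) (auto simp: sum_distrib_left algebra_simps)
  finally show ?thesis by (simp add: sum_negf)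
qed

text \<open>Moving from \<open>k\<close> to \<open>Suc k\<close>, the first sum gains its term at
  \<open>k\<close> and the subtracted sum loses its term at \<open>Suc k\<close>.\<close>

lemma alt_sum_diff_Suc:
  assumes "1 \<le> k" "k < n"
  shows "alt_sum_diff n a (Suc k) - alt_sum_diff n a k = (-1) ^ k * (a k - a (Suc k))"
proof -
  have "(\<Sum>i=Suc k..n. (-1) ^ i * a i) = (-1) ^ Suc k * a (Suc k) + (\<Sum>i=Suc (Suc k)..n. (-1) ^ i * a i)"
    using assms by (intro sum.atLeast_Suc_atMost) auto
  then show ?thesis
    using assms by (simp add: alt_sum_diff_def algebra_simps)
qed

text \<open>The range has \<open>n - 1\<close> terms, an even number, which cancel in neighbouring
  pairs. This is where the parity of \<open>n\<close> enters.\<close>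

lemma sum_alternating_odd:
  assumes "odd n"
  shows "(\<Sum>i=Suc 1..n. (-1) ^ i :: 'a::ring_1) = 0"
proof -
  have "(\<Sum>i=Suc 1..Suc (2 * m). (-1) ^ i :: 'a) = 0" for m
    by (induction m) auto
  with assms show ?thesis by (auto elim!: oddE)
qed

lemma alt_sum_diff_const:
  assumes "odd n" "1 \<le> k" "k \<le> n" "\<And>i. 1 \<le> i \<Longrightarrow> i \<le> n \<Longrightarrow> a i = c"
  shows "alt_sum_diff n a k = 0"
  using assms(2,3)
proof (induction k rule: dec_induct)
  case base
  have "alt_sum_diff n a 1 = - (\<Sum>i=Suc 1..n. (-1) ^ i * c)"
    by (simp add: alt_sum_diff_def assms(4))
  also have "\<dots> = 0"
    by (simp only: sum_distrib_right[symmetric] sum_alternating_odd[OF assms(1)] mult_zero_left minus_zero)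
  finally show ?case .
next
  case (step k)
  then show ?case
    using alt_sum_diff_Suc[of k n a] assms(4)[of k] assms(4)[of "Suc k"] by simp
qed

lemma const_if_alt_sum_diff_zero:
  assumes "\<And>k. 1 \<le> k \<Longrightarrow> k \<le> n \<Longrightarrow> alt_sum_diff n a k = 0" "1 \<le> k" "k \<le> n"
  shows "a k = a 1"
  using assms(2,3)
proof (induction k rule: dec_induct)
  case (step k)
  then show ?case
    using alt_sum_diff_Suc[of k n a] assms(1)[of k] assms(1)[of "Suc k"] by simp
qed simp

lemma alt_form_degenerate_iff:
  assumes "odd n"
  shows "(\<forall>b. alt_form n a b = 0) \<longleftrightarrow> (\<forall>k\<in>{1..n}. a k = a 1)"
proof
  assume *: "\<forall>b. alt_form n a b = 0"
  have "alt_sum_diff n a k = 0" if "1 \<le> k" "k \<le> n" for k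
  proof -
    \<comment> \<open>Testing against the unit sequence at \<open>k\<close> isolates one summand of
      \<open>alt_form_eq_sum\<close>.\<close>
    have "alt_form n a (\<lambda>i. of_bool (i = k)) = - ((-1) ^ k * alt_sum_diff n a k)"
      using that by (simp add: alt_form_eq_sum of_bool_def if_distrib if_distribR cong: if_cong)
    with * show ?thesis by simp
  qed
  then show "\<forall>k\<in>{1..n}. a k = a 1"
    using const_if_alt_sum_diff_zero[of n a] by (meson atLeastAtMost_iff)
next
  assume *: "\<forall>k\<in>{1..n}. a k = a 1"
  have "alt_sum_diff n a k = 0" if "k \<in> {1..n}" for k
    using * that alt_sum_diff_const[OF assms, of k a "a 1"] by (meson atLeastAtMost_iff)
  then show "\<forall>b. alt_form n a b = 0"
    by (simp add: alt_form_eq_sum)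
qed

lemma bounded_linear_coord:
  "bounded_linear (xcoord lab i)" "bounded_linear (ycoord lab i)"
  unfolding xcoord_def ycoord_def
  by (intro bounded_linear_compose[OF bounded_linear_vec_nth bounded_linear_vec_nth])+

lemma differential_bounded_linear: "bounded_linear f \<Longrightarrow> differential f p = f"
  using frechet_derivative_at[OF bounded_linear_imp_has_derivative]
  by (fastforce simp: differential_def)

text \<open>Coordinates are linear, hence equal to their own differentials at every base point. The
  right-hand side is free of \<open>P\<close>: the form has constant coefficients.\<close>

lemma omega_eq_alt_form:
  "omega n lab P u v =
     alt_form n (\<lambda>i. xcoord lab i u) (\<lambda>i. xcoord lab i v) +
     alt_form n (\<lambda>i. ycoord lab i u) (\<lambda>i. ycoord lab i v)"
  unfolding omega_def alt_form_def sum.distrib[symmetric]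
  by (intro sum.cong)
    (auto simp: wedge_def differential_bounded_linear bounded_linear_coord algebra_simps)

lemma closed_omega: "closed_two_form (omega n lab)"
proof -
  have "bilinear (omega n lab P)" for P
    unfolding bilinear_def omega_eq_alt_form alt_form_def sum.distrib[symmetric]
    by (intro conjI allI linearI; simp add: sum_distrib_left sum.distrib[symmetric];
        intro sum.cong; auto simp: xcoord_def ycoord_def algebra_simps)
  moreover have "omega n lab P u u = 0" for P u
    by (simp add: omega_eq_alt_form alt_form_def)
  \<comment> \<open>After rewriting, the base point disappears, so here and in
    \<open>ext_deriv\<close> only constant functions are differentiated.\<close>
  moreover have "(\<lambda>q. omega n lab q u v) differentiable (at p)" for p u v
    by (simp add: omega_eq_alt_form)
  moreover have "ext_deriv (omega n lab) p u v w = 0" for p u v w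
    by (simp add: ext_deriv_def differential_def omega_eq_alt_form)
  ultimately show ?thesis
    by (simp add: closed_two_form_def)
qed

lemma translation_field_eq: "translation_field a P = (\<chi> k. a)"
proof -
  have "translate (t *\<^sub>R a) P = P + t *\<^sub>R (\<chi> k. a)" for t
    by (simp add: translate_def vec_eq_iff)
  then show ?thesis
    unfolding translation_field_def
    by (auto intro!: vector_derivative_at derivative_eq_intros)
qed

lemma form_kernel_omega:
  assumes "n \<ge> 1" "odd n" and bij: "bij_betw lab {1..n} UNIV"
  shows "form_kernel (omega n lab) P = range (\<lambda>a. \<chi> k. a)"
proof (intro equalityI subsetI)
  fix u assume "u \<in> form_kernel (omega n lab) P"
  then have u: "omega n lab P u v = 0" for v
    by (simp add: form_kernel_def)
  have lab_inv: "inv_into {1..n} lab (lab i) = i" if "i \<in> {1..n}" for i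
    using bij that by (auto simp: bij_betw_def intro: inv_into_f_f)
  \<comment> \<open>The polygons \<open>v\<close> below reproduce \<open>b\<close> only on
    \<open>{1..n}\<close>, which is all that \<open>alt_form\<close> sees.\<close>
  have alt_form_cong: "alt_form n a b = alt_form n a b'" if "\<And>i. i \<in> {1..n} \<Longrightarrow> b i = b' i" for a b b'
    using that by (simp add: alt_form_eq_sum)
  have "alt_form n (\<lambda>i. xcoord lab i u) b = 0" for b
  proof -
    \<comment> \<open>This polygon has x-coordinates \<open>b\<close> and zero y-coordinates, so
      pairing with it leaves only the x-part of \<open>omega\<close>.\<close>
    define v :: "'a polygon" where "v = (\<chi> k. axis 1 (b (inv_into {1..n} lab k)))"
    have "alt_form n (\<lambda>i. xcoord lab i u) b = alt_form n (\<lambda>i. xcoord lab i u) (\<lambda>i. xcoord lab i v)"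
      by (rule alt_form_cong) (simp add: v_def xcoord_def lab_inv del: One_nat_def)
    also have "\<dots> = omega n lab P u v"
      by (simp add: omega_eq_alt_form v_def ycoord_def axis_def alt_form_eq_sum)
    finally show ?thesis using u by simp
  qed
  moreover have "alt_form n (\<lambda>i. ycoord lab i u) b = 0" for b
  proof -
    define v :: "'a polygon" where "v = (\<chi> k. axis 2 (b (inv_into {1..n} lab k)))"
    have "alt_form n (\<lambda>i. ycoord lab i u) b = alt_form n (\<lambda>i. ycoord lab i u) (\<lambda>i. ycoord lab i v)"
      by (rule alt_form_cong) (simp add: v_def ycoord_def lab_inv del: One_nat_def)
    also have "\<dots> = omega n lab P u v"
      by (simp add: omega_eq_alt_form v_def xcoord_def axis_def alt_form_eq_sum)
    finally show ?thesis using u by simp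
  qed
  ultimately have "u $ lab k = u $ lab 1" if "k \<in> {1..n}" for k
    using that
      alt_form_degenerate_iff[OF \<open>odd n\<close>, of "\<lambda>i. xcoord lab i u"]
      alt_form_degenerate_iff[OF \<open>odd n\<close>, of "\<lambda>i. ycoord lab i u"]
    by (auto simp: vec_eq_iff forall_2 xcoord_def ycoord_def simp del: atLeastAtMost_iff)
  moreover have "\<exists>i\<in>{1..n}. k = lab i" for k
    using bij by (auto simp: bij_betw_def)
  ultimately have "u $ k = u $ lab 1" for k
    by metis
  then have "u = (\<chi> k. u $ lab 1)"
    by (simp add: vec_eq_iff)
  then show "u \<in> range (\<lambda>a. \<chi> k. a)" by blast
next
  fix u :: "'a polygon" assume "u \<in> range (\<lambda>a. \<chi> k. a)"
  then show "u \<in> form_kernel (omega n lab) P"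
    using alt_form_degenerate_iff[OF \<open>odd n\<close>, THEN iffD2]
    by (auto simp: form_kernel_def omega_eq_alt_form xcoord_def ycoord_def)
qed

text \<open>Reindexing along \<open>lab\<close> makes this a sum over all vertices, of which exactly
  one term is nonzero at each vertex.\<close>

lemma sum_partial:
  assumes "bij_betw lab {1..n} UNIV"
  shows "(\<Sum>i=1..n. partial_x lab i) = (\<chi> k. axis 1 1)"
    and "(\<Sum>i=1..n. partial_y lab i) = (\<chi> k. axis 2 1)"
proof -
  have "(\<Sum>i=1..n. axis (lab i) c) = (\<chi> k. c)" for c :: "real ^ 2"
    using sum.reindex_bij_betw[OF assms, of "\<lambda>k. axis k c"]
    by (simp add: vec_eq_iff axis_def if_distrib if_distribR cong: if_cong)
  then show "(\<Sum>i=1..n. partial_x lab i) = (\<chi> k. axis 1 1)"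
    and "(\<Sum>i=1..n. partial_y lab i) = (\<chi> k. axis 2 1)"
    by (simp_all add: partial_x_def partial_y_def)
qed

lemma linear_diagonal: "linear (\<lambda>a::real^'m. (\<chi> k. a) :: real^'m^'n)"
  by (intro linearI) (auto simp: vec_eq_iff)

text \<open>The diagonal embedding is linear, so the image of the plane is spanned by the images of
  the two standard basis vectors.\<close>

lemma range_diagonal_eq_span:
  "range (\<lambda>a::real^2. (\<chi> k. a) :: 'n::finite polygon) = span {\<chi> k. axis 1 1, \<chi> k. axis 2 1}"
proof -
  have "(UNIV :: (real^2) set) = span {axis 1 1, axis 2 1}"
    by (subst span_Basis[symmetric], rule arg_cong[of _ _ span])
      (auto simp: Basis_vec_def UNIV_2)
  then show ?thesis
    using linear_span_image[OF linear_diagonal[where 'n = 'n], of "{axis 1 1, axis 2 1 :: real^2}"]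
    by simp
qed

lemma dim_range_diagonal: "dim (range (\<lambda>a::real^'m. (\<chi> k. a) :: real^'m^'n)) = CARD('m)"
proof -
  have "inj (\<lambda>a::real^'m. (\<chi> k. a) :: real^'m^'n)"
    by (auto simp: inj_def vec_eq_iff)
  then show ?thesis
    using dim_image_eq[OF linear_diagonal, of UNIV] by simp
qed

theorem lemma3p1:
  fixes n :: nat and lab :: "nat \<Rightarrow> 'n::finite"
  assumes "n \<ge> 3" and "odd n"
    and "bij_betw lab {1..n} UNIV"
  shows "closed_two_form (omega n lab) \<and>
    (\<forall>P. dim (form_kernel (omega n lab) P) = 2 \<and>
         form_kernel (omega n lab) P = range (\<lambda>a. translation_field a P) \<and>
         form_kernel (omega n lab) P =
           span {\<Sum>i=1..n. partial_x lab i, \<Sum>i=1..n. partial_y lab i})"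
proof -
  have "form_kernel (omega n lab) P = range (\<lambda>a. \<chi> k. a)" for P
    using assms by (intro form_kernel_omega) auto
  then show ?thesis
    by (simp only: translation_field_eq sum_partial[OF assms(3)] dim_range_diagonal closed_omega
        range_diagonal_eq_span[symmetric]) simp
qed

end
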